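(* Let $n\ge1$ be an integer and let $C_1,C_2:\{0,\dots,n\}^2\to[0,1]$ be discrete copulas with associated bistochastic matrices $A=(a_{ij})$ and $B=(b_{ij})$ and associated distributions $\alpha,\beta$ on $[n]\times[n]$ given by $a_{ij}=n\,\alpha(i,j)$ and $b_{ij}=n\,\beta(i,j)$. Let $\gamma$ be the distribution on $[n]\times[n]$ associated to the product copula of $C_1$ and $C_2$. Regard $\alpha$ as a distribution on $I=[n]\times[n]$ and $\beta$ as a distribution on $J=[n]\times[n]$, let $M=[n]$, let $p:I\to M$ be the second projection and $q:J\to M$ the first projection. Then $\alpha$ and $\beta$ are consistent with respect to $p$ and $q$, and $\gamma$ is an aggregate (marginal) of their Markov combination: identifying $I\times_M J$ with $[n]^3$ via $((i,k),(k,j))\leftrightarrow(i,k,j)$ and letting $M'=[n]\times[n]$ with the mapping $I\times_M J\to M'$, $(i,k,j)\mapsto(i,j)$, $$\gamma=(\alpha\star\beta)_{M'},\qquad\text{i.e.}\qquad \gamma(i,j)=\sum_{k=1}^n(\alpha\star\beta)(i,k,j)\quad\text{for all }i,j\in[n].$$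
   Context: $[n]=\{1,\dots,n\}$. A discrete copula $C:\{0,\dots,n\}^2\to[0,1]$ is a function such that for all $i,j\in\{0,\dots,n\}$: (C1) $C(i,0)=C(0,j)=0$; (C2) $C(i,n)=i/n$ and $C(n,j)=j/n$; (C3) $C(i-1,j-1)-C(i,j-1)-C(i-1,j)+C(i,j)\ge0$ whenever $i,j\ge1$. A matrix in $\mathbb R_{\ge0}^{n\times n}$ is bistochastic if all its row and column sums equal $1$. The discrete copulas on $\{0,\dots,n\}^2$ correspond bijectively to bistochastic matrices $A=(a_{ij})$ via $C(i,j)=\frac1n\sum_{k=1}^i\sum_{\ell=1}^j a_{k\ell}$ (known fact); $A$ is the bistochastic matrix associated to $C$, and the distribution associated to $C$ is $\frac1nA$, viewed as a probability density on $[n]\times[n]$ (it has uniform marginals $1/n$). The product copula of $C_1$ and $C_2$ is the copula whose associated bistochastic matrix is the matrix product $A\cdot B$. For a surjection $p:X\to M$ of finite sets and $f\in\mathbb R^X$, the aggregate $f_M\in\mathbb R^M$ is $f_{M,k}=\sum_{x:\,p(x)=k}f_x$. For surjections $p:I\to M$, $q:J\to M$, $I\times_M J=\{(i,j)\in I\times J:p(i)=q(j)\}$. Vectors $f\in\mathbb R^I$, $g\in\mathbb R^J$ are consistent if $f_M=g_M$, and then their Markov combination is $f\star g\in\mathbb R^{I\times_M J}$, $(f\star g)_{i,j}=f_ig_j/f_{M,p(i)}$. *)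

theory Defs
  imports "Jordan_Normal_Form.Matrix" "HOL-Library.FuncSet"
begin

text \<open>A copula is an extensional function on the grid, i.e. it is \<open>undefined\<close> off
  \<open>{0..n} \<times> {0..n}\<close>, so that equality of copulas is equality as functions on the grid.\<close>

definition discrete_copula :: "nat \<Rightarrow> (nat \<times> nat \<Rightarrow> real) \<Rightarrow> bool" where
  "discrete_copula n C \<longleftrightarrow>
     C \<in> ({0..n} \<times> {0..n}) \<rightarrow>\<^sub>E {0..1} \<and>
     (\<forall>i\<in>{0..n}. C (i, 0) = 0) \<and>
     (\<forall>j\<in>{0..n}. C (0, j) = 0) \<and>
     (\<forall>i\<in>{0..n}. C (i, n) = real i / real n) \<and>
     (\<forall>j\<in>{0..n}. C (n, j) = real j / real n) \<and>
     (\<forall>i\<in>{1..n}. \<forall>j\<in>{1..n}.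
        C (i - 1, j - 1) - C (i, j - 1) - C (i - 1, j) + C (i, j) \<ge> 0)"

text \<open>Matrices of type \<^typ>\<open>real mat\<close> are indexed from 0; \<open>entry A i j\<close> is $a_{ij}$ with
  indices in $\{1,\dots,n\}$.\<close>

definition entry :: "real mat \<Rightarrow> nat \<Rightarrow> nat \<Rightarrow> real" where
  "entry A i j = A $$ (i - 1, j - 1)"

definition bistochastic :: "nat \<Rightarrow> real mat \<Rightarrow> bool" where
  "bistochastic n A \<longleftrightarrow>
     A \<in> carrier_mat n n \<and>
     (\<forall>i\<in>{1..n}. \<forall>j\<in>{1..n}. entry A i j \<ge> 0) \<and>
     (\<forall>i\<in>{1..n}. (\<Sum>j=1..n. entry A i j) = 1) \<and>
     (\<forall>j\<in>{1..n}. (\<Sum>i=1..n. entry A i j) = 1)"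

definition copula_matrix :: "nat \<Rightarrow> (nat \<times> nat \<Rightarrow> real) \<Rightarrow> real mat" where
  "copula_matrix n C =
     (THE A. bistochastic n A \<and>
        (\<forall>i\<in>{0..n}. \<forall>j\<in>{0..n}. C (i, j) = 1 / real n * (\<Sum>k=1..i. \<Sum>l=1..j. entry A k l)))"

definition copula_distribution :: "nat \<Rightarrow> (nat \<times> nat \<Rightarrow> real) \<Rightarrow> nat \<times> nat \<Rightarrow> real" where
  "copula_distribution n C = (\<lambda>(i, j). 1 / real n * entry (copula_matrix n C) i j)"

definition product_copula ::
  "nat \<Rightarrow> (nat \<times> nat \<Rightarrow> real) \<Rightarrow> (nat \<times> nat \<Rightarrow> real) \<Rightarrow> nat \<times> nat \<Rightarrow> real" where
  "product_copula n C1 C2 =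
     (THE C. discrete_copula n C \<and> copula_matrix n C = copula_matrix n C1 * copula_matrix n C2)"

text \<open>A vector in $\mathbb R^X$ is a function of which only the values on \<open>X\<close> matter.\<close>

definition aggregate :: "'x set \<Rightarrow> ('x \<Rightarrow> 'm) \<Rightarrow> ('x \<Rightarrow> real) \<Rightarrow> 'm \<Rightarrow> real" where
  "aggregate X p f k = (\<Sum>x\<in>{x\<in>X. p x = k}. f x)"

definition fibre_product ::
  "'i set \<Rightarrow> 'j set \<Rightarrow> ('i \<Rightarrow> 'm) \<Rightarrow> ('j \<Rightarrow> 'm) \<Rightarrow> ('i \<times> 'j) set" where
  "fibre_product I J p q = {(i, j) \<in> I \<times> J. p i = q j}"

definition consistent ::
  "'i set \<Rightarrow> 'j set \<Rightarrow> 'm set \<Rightarrow> ('i \<Rightarrow> 'm) \<Rightarrow> ('j \<Rightarrow> 'm) \<Rightarrow> ('i \<Rightarrow> real) \<Rightarrow> ('j \<Rightarrow> real) \<Rightarrow> bool" where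
  "consistent I J M p q f g \<longleftrightarrow> (\<forall>k\<in>M. aggregate I p f k = aggregate J q g k)"

definition markov_combination ::
  "'i set \<Rightarrow> ('i \<Rightarrow> 'm) \<Rightarrow> ('i \<Rightarrow> real) \<Rightarrow> ('j \<Rightarrow> real) \<Rightarrow> 'i \<times> 'j \<Rightarrow> real" where
  "markov_combination I p f g = (\<lambda>(i, j). f i * g j / aggregate I p f (p i))"

end

theory Submission
  imports Defs
begin

text \<open>All marginals equal $1/n$, so the denominator of the Markov combination is constant and
  $\sum_k \alpha(i,k)\,\beta(k,j)/(1/n)$ is $1/n$ times the $(i,j)$ entry of $A \cdot B$. The remaining
  work is the bijection between copulas and bistochastic matrices, by which the two definite
  descriptions in the definitions denote what they should.\<close>

text \<open>The body is the predicate under the definite description in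
  \<open>copula_matrix\<close>, so that this description can be folded and then evaluated by
  existence and uniqueness.\<close>

definition associated :: "nat \<Rightarrow> (nat \<times> nat \<Rightarrow> real) \<Rightarrow> real mat \<Rightarrow> bool" where
  "associated n C A \<longleftrightarrow> bistochastic n A \<and>
     (\<forall>i\<in>{0..n}. \<forall>j\<in>{0..n}. C (i, j) = 1 / real n * (\<Sum>k=1..i. \<Sum>l=1..j. entry A k l))"

section \<open>Rectangle sums and mixed differences\<close>

text \<open>Summation telescopes in both directions: the outer induction adds one row, the inner one
  collapses it to its ends. With the next lemma this makes partial summation and mixed differences
  inverse to each other, up to values on the axes.\<close>

lemma rectangle_sum_telescope:
  fixes f :: "nat \<times> nat \<Rightarrow> real"
  shows "(\<Sum>k=1..i. \<Sum>l=1..j. f (k - 1, l - 1) - f (k, l - 1) - f (k - 1, l) + f (k, l))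
    = f (i, j) - f (0, j) - f (i, 0) + f (0, 0)"
proof (induction i)
  case (Suc i)
  have "(\<Sum>l=1..j. f (i, l - 1) - f (Suc i, l - 1) - f (i, l) + f (Suc i, l))
    = f (i, 0) - f (Suc i, 0) - f (i, j) + f (Suc i, j)"
    by (induction j) auto
  with Suc show ?case by simp
qed simp

text \<open>By inclusion-exclusion on four nested rectangles only the corner cell survives.\<close>

lemma rectangle_sum_difference:
  fixes f :: "nat \<Rightarrow> nat \<Rightarrow> real"
  assumes "i \<ge> 1" "j \<ge> 1"
  defines "S \<equiv> \<lambda>i j. \<Sum>k=1..i. \<Sum>l=1..j. f k l"
  shows "S (i - 1) (j - 1) - S i (j - 1) - S (i - 1) j + S i j = f i j"
proof -
  obtain i' j' where "i = Suc i'" "j = Suc j'"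
    using assms(1,2) by (cases i; cases j) auto
  then show ?thesis
    unfolding S_def by simp
qed

section \<open>Matrix entries indexed from 1, and products of bistochastic matrices\<close>

lemma entry_mat_eqI:
  assumes "A \<in> carrier_mat n n" "B \<in> carrier_mat n n"
    and "\<And>i j. i \<in> {1..n} \<Longrightarrow> j \<in> {1..n} \<Longrightarrow> entry A i j = entry B i j"
  shows "A = B"
proof (rule eq_matI)
  fix i j assume "i < dim_row B" "j < dim_col B"
  with assms(2) have "Suc i \<in> {1..n}" "Suc j \<in> {1..n}" by auto
  from assms(3)[OF this] show "A $$ (i, j) = B $$ (i, j)" by (simp add: entry_def)
qed (use assms(1,2) in auto)

lemma entry_mult:
  assumes "A \<in> carrier_mat n n" "B \<in> carrier_mat n n" "i \<in> {1..n}" "j \<in> {1..n}"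
  shows "entry (A * B) i j = (\<Sum>k=1..n. entry A i k * entry B k j)"
proof -
  have "entry (A * B) i j = (\<Sum>k<n. A $$ (i - 1, k) * B $$ (k, j - 1))"
    using assms by (auto simp: entry_def scalar_prod_def lessThan_atLeast0 intro!: sum.cong)
  also have "\<dots> = (\<Sum>k=1..n. entry A i k * entry B k j)"
    unfolding entry_def
    by (rule sum.reindex_bij_witness[of _ "\<lambda>k. k - 1" Suc]) auto
  finally show ?thesis .
qed

text \<open>Exchanging the two sums isolates a row sum of \<open>B\<close> in the row case and a
  column sum of \<open>A\<close> in the column case; each equals 1.\<close>

lemma bistochastic_mult:
  assumes A: "bistochastic n A" and B: "bistochastic n B"
  shows "bistochastic n (A * B)"
proof -
  have c: "A \<in> carrier_mat n n" "B \<in> carrier_mat n n"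
    using A B by (auto simp: bistochastic_def)
  have nonneg: "entry (A * B) i j \<ge> 0" if "i \<in> {1..n}" "j \<in> {1..n}" for i j
    using A B that unfolding entry_mult[OF c that]
    by (intro sum_nonneg mult_nonneg_nonneg) (auto simp: bistochastic_def)
  have row: "(\<Sum>j=1..n. entry (A * B) i j) = 1" if i: "i \<in> {1..n}" for i
  proof -
    have "(\<Sum>j=1..n. entry (A * B) i j) = (\<Sum>j=1..n. \<Sum>k=1..n. entry A i k * entry B k j)"
      using entry_mult[OF c i] by (intro sum.cong) auto
    also have "\<dots> = (\<Sum>k=1..n. entry A i k * (\<Sum>j=1..n. entry B k j))"
      by (subst sum.swap) (simp add: sum_distrib_left)
    also have "\<dots> = (\<Sum>k=1..n. entry A i k)"
      using B by (intro sum.cong) (auto simp: bistochastic_def)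
    finally show ?thesis
      using A i by (simp add: bistochastic_def)
  qed
  have col: "(\<Sum>i=1..n. entry (A * B) i j) = 1" if j: "j \<in> {1..n}" for j
  proof -
    have "(\<Sum>i=1..n. entry (A * B) i j) = (\<Sum>i=1..n. \<Sum>k=1..n. entry A i k * entry B k j)"
      using entry_mult[OF c _ j] by (intro sum.cong) auto
    also have "\<dots> = (\<Sum>k=1..n. (\<Sum>i=1..n. entry A i k) * entry B k j)"
      by (subst sum.swap) (simp add: sum_distrib_right)
    also have "\<dots> = (\<Sum>k=1..n. entry B k j)"
      using A by (intro sum.cong) (auto simp: bistochastic_def)
    finally show ?thesis
      using B j by (simp add: bistochastic_def)
  qed
  show ?thesis
    unfolding bistochastic_def using c nonneg row col by auto
qed

section \<open>The bijection between discrete copulas and bistochastic matrices\<close>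

text \<open>Partial summation is inverted by mixed differences, so the copula determines every
  entry; uniqueness of the associated matrix follows.\<close>

lemma associated_entry:
  assumes "n \<ge> 1" "associated n C A" and i: "i \<in> {1..n}" and j: "j \<in> {1..n}"
  shows "entry A i j = real n * (C (i - 1, j - 1) - C (i, j - 1) - C (i - 1, j) + C (i, j))"
proof -
  have "C (i, j) = 1 / real n * (\<Sum>k=1..i. \<Sum>l=1..j. entry A k l)"
    if "i \<le> n" "j \<le> n" for i j
    using assms(2) that by (auto simp: associated_def)
  then have "real n * C (i, j) = (\<Sum>k=1..i. \<Sum>l=1..j. entry A k l)"
    if "i \<le> n" "j \<le> n" for i j
    using that assms(1) by simp
  moreover have "i - 1 \<le> n" "j - 1 \<le> n" using i j by auto
  ultimately show ?thesis
    using i j rectangle_sum_difference[of i j "entry A"] by (simp add: ring_distribs)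
qed

lemma associated_unique:
  assumes "n \<ge> 1" "associated n C A" "associated n C B"
  shows "A = B"
proof (rule entry_mat_eqI)
  show "A \<in> carrier_mat n n" "B \<in> carrier_mat n n"
    using assms by (auto simp: associated_def bistochastic_def)
qed (simp add: associated_entry[OF assms(1,2)] associated_entry[OF assms(1,3)])

lemma copula_matrix_eqI:
  assumes "n \<ge> 1" "associated n C A"
  shows "copula_matrix n C = A"
  unfolding copula_matrix_def associated_def[symmetric]
  using assms associated_unique by blast

lemma ex_associated:
  assumes n: "n \<ge> 1" and C: "discrete_copula n C"
  shows "\<exists>A. associated n C A"
proof -
  \<comment> \<open>Since matrices are indexed from 0, position (i, j) holds the cell whose upper
    corner is (i + 1, j + 1).\<close>
  define A where "A = mat n n (\<lambda>(i, j).
    real n * (C (i, j) - C (i + 1, j) - C (i, j + 1) + C (i + 1, j + 1)))"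
  have e: "entry A i j = real n * (C (i - 1, j - 1) - C (i, j - 1) - C (i - 1, j) + C (i, j))"
    if "i \<in> {1..n}" "j \<in> {1..n}" for i j
    using that unfolding A_def entry_def by auto
  have boundary: "C (i, 0) = 0" "C (0, i) = 0" "C (i, n) = real i / real n" "C (n, i) = real i / real n"
    if "i \<le> n" for i
    using C that unfolding discrete_copula_def by auto
  have rect: "(\<Sum>k=1..i. \<Sum>l=1..j. entry A k l) = real n * C (i, j)" if "i \<le> n" "j \<le> n" for i j
  proof -
    have "(\<Sum>k=1..i. \<Sum>l=1..j. entry A k l) = real n *
      (\<Sum>k=1..i. \<Sum>l=1..j. C (k - 1, l - 1) - C (k, l - 1) - C (k - 1, l) + C (k, l))"
      unfolding sum_distrib_left using that by (intro sum.cong refl e) auto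
    \<comment> \<open>The three other corner terms lie on the axes, where \<open>C\<close>
      vanishes.\<close>
    also have "\<dots> = real n * C (i, j)"
      unfolding rectangle_sum_telescope using boundary that by simp
    finally show ?thesis .
  qed
  have row: "(\<Sum>j=1..n. entry A i j) = 1" if i: "i \<in> {1..n}" for i
  proof -
    obtain i' where i': "i = Suc i'" using i by (cases i) auto
    \<comment> \<open>A row is the difference of two full-width rectangles of heights i and i - 1;
      the boundary values of \<open>C\<close> make this i - (i - 1) = 1. Columns are treated
      alike.\<close>
    have "(\<Sum>j=1..n. entry A i j) = real n * C (i, n) - real n * C (i', n)"
      using rect[of i n] rect[of i' n] i i' by simp
    then show ?thesis using boundary i i' n by simp
  qed
  have col: "(\<Sum>i=1..n. entry A i j) = 1" if j: "j \<in> {1..n}" for j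
  proof -
    obtain j' where j': "j = Suc j'" using j by (cases j) auto
    have "(\<Sum>i=1..n. entry A i j) = real n * C (n, j) - real n * C (n, j')"
      using rect[of n j] rect[of n j'] j j' by (simp add: sum.distrib)
    then show ?thesis using boundary j j' n by simp
  qed
  have nonneg: "entry A i j \<ge> 0" if "i \<in> {1..n}" "j \<in> {1..n}" for i j
    unfolding e[OF that] using C that by (simp add: discrete_copula_def)
  have "bistochastic n A"
    unfolding bistochastic_def using nonneg row col by (auto simp: A_def)
  then show ?thesis
    unfolding associated_def using rect n by (intro exI[of _ A]) auto
qed

lemma associated_copula_matrix:
  assumes "n \<ge> 1" "discrete_copula n C"
  shows "associated n C (copula_matrix n C)"
proof -
  obtain A where "associated n C A" using ex_associated[OF assms] ..
  with copula_matrix_eqI[OF assms(1) this] show ?thesis by simp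
qed

text \<open>On the grid each copula is recovered from the common matrix by partial sums; off the
  grid both are \<open>undefined\<close>, whence equality as functions.\<close>

lemma copula_matrix_inj:
  assumes "n \<ge> 1" "discrete_copula n C" "discrete_copula n D"
    and "copula_matrix n C = copula_matrix n D"
  shows "C = D"
proof (rule PiE_ext)
  show "C \<in> ({0..n} \<times> {0..n}) \<rightarrow>\<^sub>E {0..1}" "D \<in> ({0..n} \<times> {0..n}) \<rightarrow>\<^sub>E {0..1}"
    using assms(2,3) by (auto simp: discrete_copula_def)
  show "C x = D x" if "x \<in> {0..n} \<times> {0..n}" for x
    using associated_copula_matrix[OF assms(1,2)] associated_copula_matrix[OF assms(1,3)]
      assms(4) that
    by (auto simp: associated_def)
qed

lemma ex_copula_associated:
  assumes n: "n \<ge> 1" and A: "bistochastic n A"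
  shows "\<exists>C. discrete_copula n C \<and> associated n C A"
proof -
  define S where "S = (\<lambda>i j. \<Sum>k=1..i. \<Sum>l=1..j. entry A k l)"
  \<comment> \<open>The restricted lambda makes \<open>C\<close> extensional, as
    \<open>discrete_copula\<close> demands.\<close>
  define C where "C = (\<lambda>(i, j)\<in>{0..n} \<times> {0..n}. 1 / real n * S i j)"
  have C: "C (i, j) = S i j / real n" if "i \<le> n" "j \<le> n" for i j
    using that by (simp add: C_def)
  have nonneg: "entry A i j \<ge> 0" if "i \<in> {1..n}" "j \<in> {1..n}" for i j
    using A that by (simp add: bistochastic_def)
  have Sr: "S i n = real i" if "i \<le> n" for i
  proof -
    have "S i n = (\<Sum>k=1..i. 1)"
      unfolding S_def using A that by (intro sum.cong) (auto simp: bistochastic_def)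
    then show ?thesis by simp
  qed
  have Sc: "S n j = real j" if "j \<le> n" for j
  proof -
    have "S n j = (\<Sum>l=1..j. \<Sum>k=1..n. entry A k l)"
      unfolding S_def by (rule sum.swap)
    also have "\<dots> = (\<Sum>l=1..j. 1)"
      using A that by (intro sum.cong) (auto simp: bistochastic_def)
    finally show ?thesis by simp
  qed
  have S0: "S i j \<ge> 0" if "i \<le> n" "j \<le> n" for i j
    unfolding S_def using that by (intro sum_nonneg nonneg) auto
  have Sn: "S i j \<le> real n" if "i \<le> n" "j \<le> n" for i j
  proof -
    \<comment> \<open>Entries are nonnegative, so widening the rectangle to full width only adds
      mass, and the full-width sum is i \<le> n. This gives the bound 1 on \<open>C\<close>.\<close>
    have "S i j \<le> S i n"
      unfolding S_def using that by (intro sum_mono sum_mono2 nonneg) auto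
    with Sr[OF that(1)] that show ?thesis by simp
  qed
  have increment: "C (i - 1, j - 1) - C (i, j - 1) - C (i - 1, j) + C (i, j) \<ge> 0"
    if i: "i \<in> {1..n}" and j: "j \<in> {1..n}" for i j
  proof -
    have "C (i - 1, j - 1) - C (i, j - 1) - C (i - 1, j) + C (i, j)
      = (S (i - 1) (j - 1) - S i (j - 1) - S (i - 1) j + S i j) / real n"
      using i j by (auto simp: C add_divide_distrib diff_divide_distrib)
    also have "\<dots> = entry A i j / real n"
      using i j rectangle_sum_difference[of i j "entry A"] unfolding S_def by simp
    finally show ?thesis using nonneg[OF i j] by simp
  qed
  have "C \<in> ({0..n} \<times> {0..n}) \<rightarrow>\<^sub>E {0..1}"
    unfolding C_def using S0 Sn n by auto
  moreover have "S i 0 = 0" "S 0 i = 0" for i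
    by (simp_all add: S_def)
  ultimately have "discrete_copula n C"
    unfolding discrete_copula_def using increment by (simp add: C Sr Sc)
  moreover have "associated n C A"
    unfolding associated_def using A by (simp add: C S_def)
  ultimately show ?thesis by blast
qed

text \<open>The product of the two matrices is bistochastic, hence comes from some copula, and
  injectivity of \<open>copula_matrix\<close> makes that copula unique; so the definite description
  in \<open>product_copula\<close> denotes it.\<close>

lemma copula_matrix_product_copula:
  assumes n: "n \<ge> 1" and "discrete_copula n C1" "discrete_copula n C2"
  shows "copula_matrix n (product_copula n C1 C2) = copula_matrix n C1 * copula_matrix n C2"
proof -
  let ?P = "\<lambda>C. discrete_copula n C \<and> copula_matrix n C = copula_matrix n C1 * copula_matrix n C2"
  have "bistochastic n (copula_matrix n C1 * copula_matrix n C2)"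
    using associated_copula_matrix assms by (intro bistochastic_mult) (auto simp: associated_def)
  then have "\<exists>C. ?P C"
    using ex_copula_associated copula_matrix_eqI n by blast
  then have "\<exists>!C. ?P C"
    using copula_matrix_inj[OF n] by metis
  from theI'[OF this] show ?thesis
    by (simp add: product_copula_def)
qed

section \<open>Marginals, Markov combination and aggregation\<close>

theorem mainTheorem4:
  fixes n :: nat
    and C1 C2 :: "nat \<times> nat \<Rightarrow> real"
    and A B :: "real mat"
    and \<alpha> \<beta> \<gamma> :: "nat \<times> nat \<Rightarrow> real"
    and I J :: "(nat \<times> nat) set" and M :: "nat set" and M' :: "(nat \<times> nat) set"
    and p q :: "nat \<times> nat \<Rightarrow> nat"
    and r :: "(nat \<times> nat) \<times> (nat \<times> nat) \<Rightarrow> nat \<times> nat"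
  assumes "n \<ge> 1"
    and "discrete_copula n C1" and "discrete_copula n C2"
    and "A = copula_matrix n C1" and "B = copula_matrix n C2"
    and "\<forall>i\<in>{1..n}. \<forall>j\<in>{1..n}. entry A i j = real n * \<alpha> (i, j)"
    and "\<forall>i\<in>{1..n}. \<forall>j\<in>{1..n}. entry B i j = real n * \<beta> (i, j)"
    and "\<forall>i\<in>{1..n}. \<forall>j\<in>{1..n}.
           \<gamma> (i, j) = copula_distribution n (product_copula n C1 C2) (i, j)"
    and "I = {1..n} \<times> {1..n}" and "J = {1..n} \<times> {1..n}"
    and "M = {1..n}" and "M' = {1..n} \<times> {1..n}"
    and "p = snd" and "q = fst"
    and "r = (\<lambda>((i, k), (k', j)). (i, j))"
  shows "consistent I J M p q \<alpha> \<beta> \<and>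
    bij_betw (\<lambda>(i, k, j). ((i, k), (k, j)))
      ({1..n} \<times> {1..n} \<times> {1..n}) (fibre_product I J p q) \<and>
    (\<forall>x\<in>M'. \<gamma> x =
      aggregate (fibre_product I J p q) r (markov_combination I p \<alpha> \<beta>) x) \<and>
    (\<forall>i\<in>{1..n}. \<forall>j\<in>{1..n}.
      \<gamma> (i, j) = (\<Sum>k=1..n. markov_combination I p \<alpha> \<beta> ((i, k), (k, j))))"
proof -
  note n = assms(1) and alpha = assms(6) and beta = assms(7) and gamma = assms(8)
  note sets = assms(9-12) and maps = assms(13-15)
  have A: "bistochastic n A" and B: "bistochastic n B"
    using associated_copula_matrix[OF n] assms(2-5) by (auto simp: associated_def)
  \<comment> \<open>The fibre of k under \<open>snd\<close> is the k-th column, so the marginal is a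
    column sum of \<open>A\<close> divided by n. For \<open>\<beta>\<close> and \<open>fst\<close>
    it is a row sum of \<open>B\<close> divided by n.\<close>
  have marginal_alpha: "aggregate I p \<alpha> k = 1 / real n" if k: "k \<in> {1..n}" for k
  proof -
    have "aggregate I p \<alpha> k = (\<Sum>i=1..n. \<alpha> (i, k))"
      unfolding aggregate_def sets maps
      by (rule sum.reindex_bij_witness[of _ "\<lambda>i. (i, k)" fst]) (use k in auto)
    also have "real n * \<dots> = (\<Sum>i=1..n. entry A i k)"
      using alpha k unfolding sum_distrib_left by (intro sum.cong) auto
    also have "\<dots> = 1"
      using A k by (simp add: bistochastic_def)
    finally show ?thesis using n by (simp add: field_simps)
  qed
  have marginal_beta: "aggregate J q \<beta> k = 1 / real n" if k: "k \<in> {1..n}" for k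
  proof -
    have "aggregate J q \<beta> k = (\<Sum>j=1..n. \<beta> (k, j))"
      unfolding aggregate_def sets maps
      by (rule sum.reindex_bij_witness[of _ "\<lambda>j. (k, j)" snd]) (use k in auto)
    also have "real n * \<dots> = (\<Sum>j=1..n. entry B k j)"
      using beta k unfolding sum_distrib_left by (intro sum.cong) auto
    also have "\<dots> = 1"
      using B k by (simp add: bistochastic_def)
    finally show ?thesis using n by (simp add: field_simps)
  qed
  have gamma_sum: "\<gamma> (i, j) = (\<Sum>k=1..n. markov_combination I p \<alpha> \<beta> ((i, k), (k, j)))"
    if i: "i \<in> {1..n}" and j: "j \<in> {1..n}" for i j
  proof -
    have "\<gamma> (i, j) = 1 / real n * entry (A * B) i j"
      using gamma i j assms(4,5) copula_matrix_product_copula[OF n assms(2,3)]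
      by (simp add: copula_distribution_def)
    also have "\<dots> = 1 / real n * (\<Sum>k=1..n. entry A i k * entry B k j)"
      using A B entry_mult[OF _ _ i j] by (simp add: bistochastic_def)
    also have "\<dots> = (\<Sum>k=1..n. markov_combination I p \<alpha> \<beta> ((i, k), (k, j)))"
      unfolding sum_distrib_left
    proof (rule sum.cong)
      fix k assume k: "k \<in> {1..n}"
      have "p (i, k) = k" by (simp add: maps)
      \<comment> \<open>\<open>\<alpha>\<close> and \<open>\<beta>\<close> each contribute a factor
        1/n, and the denominator 1/n cancels one of them.\<close>
      with alpha beta i j k n marginal_alpha[OF k]
      show "1 / real n * (entry A i k * entry B k j)
        = markov_combination I p \<alpha> \<beta> ((i, k), (k, j))"
        by (simp add: markov_combination_def)
    qed simp
    finally show ?thesis .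
  qed
  \<comment> \<open>Membership in the fibre product forces the two middle indices to agree, so the
    fibre of \<open>r\<close> over (i, j) is parametrized by this common index k.\<close>
  have aggregate_fibre: "aggregate (fibre_product I J p q) r f (i, j) = (\<Sum>k=1..n. f ((i, k), (k, j)))"
    if "i \<in> {1..n}" "j \<in> {1..n}" for f i j
    unfolding aggregate_def fibre_product_def sets maps
    by (rule sum.reindex_bij_witness[of _ "\<lambda>k. ((i, k), (k, j))" "\<lambda>x. snd (fst x)"])
      (use that in auto)
  have "consistent I J M p q \<alpha> \<beta>"
    unfolding consistent_def sets(3) using marginal_alpha marginal_beta by simp
  moreover have "bij_betw (\<lambda>(i, k, j). ((i, k), (k, j)))
      ({1..n} \<times> {1..n} \<times> {1..n}) (fibre_product I J p q)"
    unfolding fibre_product_def sets maps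
    by (rule bij_betw_byWitness[where f' = "\<lambda>((i, k), (k', j)). (i, k, j)"]) auto
  moreover have "\<forall>x\<in>M'. \<gamma> x =
      aggregate (fibre_product I J p q) r (markov_combination I p \<alpha> \<beta>) x"
    unfolding sets(4) using gamma_sum aggregate_fibre by auto
  ultimately show ?thesis
    using gamma_sum by blast
qed

end
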